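(* Let $c:\mathsf{X}\times\mathsf{Y}\to[0,\infty)$ be a (measurable) cost function such that $(x,y)\mapsto c(x,y)-f(x)-g(y)$ is discontinuous for any functions $f:\mathsf{X}\to\mathbb{R}$ and $g:\mathsf{Y}\to\mathbb{R}$. Then the stability of entropic optimal transport fails for $c$; that is, there are marginals $(\mu_{n},\nu_{n})\in\mathcal{P}(\mathsf{X})\times\mathcal{P}(\mathsf{Y})$ converging weakly to some $(\mu,\nu)\in\mathcal{P}(\mathsf{X})\times\mathcal{P}(\mathsf{Y})$ and $(c,1)$-cyclically invariant couplings $\pi_{n}\in\Pi(\mu_{n},\nu_{n})$ converging weakly to some $\pi\in\Pi(\mu,\nu)$, where $\pi$ is not $(c,1)$-cyclically invariant.
   Context: $(\mathsf{X},d)$ and $(\mathsf{Y},d)$ are complete separable metric spaces; $\mathsf{X}\times\mathsf{Y}$ carries the metric $d((x,y),(x',y'))=\max\{d(x,x'),d(y,y')\}$. $\mathcal{P}(\cdot)$ denotes the Borel probability measures; $\Pi(\mu,\nu)$ is the set of couplings, i.e. probability measures on $\mathsf{X}\times\mathsf{Y}$ with first marginal $\mu$ and second marginal $\nu$. Definition: for marginals $\mu,\nu$ with $P:=\mu\otimes\nu$ and $\varepsilon>0$, a coupling $\pi\in\Pi(\mu,\nu)$ is $(c,\varepsilon)$-cyclically invariant if $\pi\sim P$ (mutually absolutely continuous) and its density admits a version $d\pi/dP:\mathsf{X}\times\mathsf{Y}\to(0,\infty)$ such that $$\prod_{i=1}^{k} \frac{d\pi}{dP}(x_{i},y_{i})=\exp\bigg(-\frac{1}{\varepsilon}\bigg[\sum_{i=1}^{k}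 c(x_{i},y_{i}) - \sum_{i=1}^{k} c(x_{i},y_{i+1})\bigg]\bigg)\prod_{i=1}^{k} \frac{d\pi}{dP}(x_{i},y_{i+1})$$ for all $k\in\mathbb{N}$ and $(x_i,y_i)_{i=1}^k\subset\mathsf{X}\times\mathsf{Y}$, where $y_{k+1}:=y_1$. *)

theory Defs
  imports "HOL-Probability.Probability"
begin

(* The library metric on 'a \<times> 'b is the Euclidean combination of the two distances rather than
   their maximum.  Both induce the product topology, and only the topology of the product (via its
   Borel sets, continuous functions and weak convergence) is used below. *)

definition borel_probs :: "'a::topological_space measure set" where
  "borel_probs = {M. prob_space M \<and> sets M = sets borel}"

definition weakly_converges :: "(nat \<Rightarrow> 'a::topological_space measure) \<Rightarrow> 'a measure \<Rightarrow> bool" where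
  "weakly_converges Ms M \<longleftrightarrow>
     (\<forall>f :: 'a \<Rightarrow> real. continuous_on UNIV f \<and> bounded (range f) \<longrightarrow>
        (\<lambda>n. \<integral>z. f z \<partial>Ms n) \<longlonglongrightarrow> (\<integral>z. f z \<partial>M))"

definition couplings ::
  "'a::topological_space measure \<Rightarrow> 'b::topological_space measure \<Rightarrow> ('a \<times> 'b) measure set" where
  "couplings \<mu> \<nu> = {\<pi> \<in> borel_probs. distr \<pi> borel fst = \<mu> \<and> distr \<pi> borel snd = \<nu>}"

(* Only the density equation is almost-everywhere information: the cycle identity is required at all
   points, including those outside the supports of the marginals.  The hypothesis y (k + 1) = y 1 is
   the cyclic convention for the index. *)
definition cyclically_invariant ::
  "('a::topological_space \<times> 'b::topological_space \<Rightarrow> real) \<Rightarrow> real \<Rightarrow>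
   'a measure \<Rightarrow> 'b measure \<Rightarrow> ('a \<times> 'b) measure \<Rightarrow> bool" where
  "cyclically_invariant c \<epsilon> \<mu> \<nu> \<pi> \<longleftrightarrow>
     \<pi> \<in> couplings \<mu> \<nu> \<and>
     absolutely_continuous (\<mu> \<Otimes>\<^sub>M \<nu>) \<pi> \<and> absolutely_continuous \<pi> (\<mu> \<Otimes>\<^sub>M \<nu>) \<and>
     (\<exists>Z :: 'a \<times> 'b \<Rightarrow> real.
        Z \<in> borel_measurable borel \<and> (\<forall>z. Z z > 0) \<and>
        \<pi> = density (\<mu> \<Otimes>\<^sub>M \<nu>) (\<lambda>z. ennreal (Z z)) \<and>
        (\<forall>k\<ge>1. \<forall>(x :: nat \<Rightarrow> 'a) (y :: nat \<Rightarrow> 'b). y (k + 1) = y 1 \<longrightarrow>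
           (\<Prod>i=1..k. Z (x i, y i)) =
             exp (- (1 / \<epsilon>) * ((\<Sum>i=1..k. c (x i, y i)) - (\<Sum>i=1..k. c (x i, y (i + 1))))) *
             (\<Prod>i=1..k. Z (x i, y (i + 1)))))"

end

theory Submission
  imports Defs
begin

text \<open>
  Fix base points \<open>x\<^sub>0\<close>, \<open>y\<^sub>0\<close> and write \<open>D(x, y) = c(x, y) - c(x, y\<^sub>0) - c(x\<^sub>0, y) + c(x\<^sub>0, y\<^sub>0)\<close>.
  This function has the form \<open>c - f - g\<close>, so the hypothesis makes it discontinuous, whatever the base
  points are.  Cyclic invariance sees \<open>c\<close> only through such cross differences: if both marginals are
  uniform on two points, \<open>{x\<^sub>0, x}\<close> and \<open>{y\<^sub>0, y}\<close>, then the couplings form a one-parameter family,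
  indexed by the probability \<open>r\<close> of choosing the two new points together or the two base points
  together, and invariance of the coupling is the single equation \<open>r\<^sup>2 = exp(-D(x, y)) (1 - r)\<^sup>2\<close>, that
  is, \<open>r = 1 / (1 + exp(D(x, y) / 2))\<close>.

  Let \<open>(x\<^sub>n, y\<^sub>n)\<close> converge to a discontinuity \<open>(x, y)\<close> of \<open>D\<close> along which \<open>D(x\<^sub>n, y\<^sub>n)\<close> does not tend to
  \<open>D(x, y)\<close>.  The values \<open>r\<^sub>n\<close> belonging to \<open>D(x\<^sub>n, y\<^sub>n)\<close> lie in the compact interval \<open>[0, 1]\<close>, so along a
  subsequence they converge to some \<open>r\<close> other than the value belonging to \<open>D(x, y)\<close>.  Marginals and
  couplings then converge weakly, and the limit coupling is not invariant.  Passing to \<open>r\<^sub>n\<close> treats all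
  kinds of discontinuity alike, including \<open>D(x\<^sub>n, y\<^sub>n)\<close> escaping to infinity, where the limit coupling
  is not even equivalent to the product of the marginals.

  The limit has to live on four distinct points: if \<open>x = x\<^sub>0\<close> or \<open>y = y\<^sub>0\<close>, the limit marginals would
  collapse and every coupling of them would be the product.  The lemma
  \<open>cross_difference_discontinuous_off_axes\<close> supplies base points for which this does not happen.
\<close>

section \<open>Cross differences of the cost\<close>

definition cross_difference :: "('a \<times> 'b \<Rightarrow> real) \<Rightarrow> 'a \<Rightarrow> 'b \<Rightarrow> 'a \<times> 'b \<Rightarrow> real" where
  "cross_difference c x\<^sub>0 y\<^sub>0 z =
     c z - c (fst z, y\<^sub>0) - c (x\<^sub>0, snd z) + c (x\<^sub>0, y\<^sub>0)"

text \<open>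
  Moving a base point changes the cross difference by a function of one variable, and that function
  is a section of the original cross difference.  Hence continuity at \<open>(a, b)\<close> for one base point can
  be inferred from continuity for another one together with continuity at a point where the two
  differ.
\<close>

lemma isCont_cross_difference_change_x:
  fixes c :: "'a::t2_space \<times> 'b::t2_space \<Rightarrow> real"
  assumes "isCont (cross_difference c x\<^sub>1 y\<^sub>0) (a, b)"
    and "isCont (cross_difference c x\<^sub>0 y\<^sub>0) (x\<^sub>1, b)"
  shows "isCont (cross_difference c x\<^sub>0 y\<^sub>0) (a, b)"
proof -
  have "isCont (\<lambda>z. cross_difference c x\<^sub>0 y\<^sub>0 (x\<^sub>1, snd z)) (a, b)"
    by (rule isCont_o2[where g = "cross_difference c x\<^sub>0 y\<^sub>0"]) (auto intro!: continuous_intros assms)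
  then have "isCont (\<lambda>z. cross_difference c x\<^sub>1 y\<^sub>0 z + cross_difference c x\<^sub>0 y\<^sub>0 (x\<^sub>1, snd z)) (a, b)"
    by (intro continuous_intros assms)
  also have "(\<lambda>z. cross_difference c x\<^sub>1 y\<^sub>0 z + cross_difference c x\<^sub>0 y\<^sub>0 (x\<^sub>1, snd z)) =
      cross_difference c x\<^sub>0 y\<^sub>0"
    by (simp add: cross_difference_def fun_eq_iff)
  finally show ?thesis .
qed

lemma isCont_cross_difference_change_y:
  fixes c :: "'a::t2_space \<times> 'b::t2_space \<Rightarrow> real"
  assumes "isCont (cross_difference c x\<^sub>0 y\<^sub>1) (a, b)"
    and "isCont (cross_difference c x\<^sub>0 y\<^sub>0) (a, y\<^sub>1)"
  shows "isCont (cross_difference c x\<^sub>0 y\<^sub>0) (a, b)"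
proof -
  have "isCont (\<lambda>z. cross_difference c x\<^sub>0 y\<^sub>0 (fst z, y\<^sub>1)) (a, b)"
    by (rule isCont_o2[where g = "cross_difference c x\<^sub>0 y\<^sub>0"]) (auto intro!: continuous_intros assms)
  then have "isCont (\<lambda>z. cross_difference c x\<^sub>0 y\<^sub>1 z + cross_difference c x\<^sub>0 y\<^sub>0 (fst z, y\<^sub>1)) (a, b)"
    by (intro continuous_intros assms)
  also have "(\<lambda>z. cross_difference c x\<^sub>0 y\<^sub>1 z + cross_difference c x\<^sub>0 y\<^sub>0 (fst z, y\<^sub>1)) =
      cross_difference c x\<^sub>0 y\<^sub>0"
    by (simp add: cross_difference_def fun_eq_iff)
  finally show ?thesis .
qed

text \<open>
  If every cross difference were continuous away from the two axes through its own base point, then a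
  change of the first base coordinate would extend continuity to \<open>x = x\<^sub>0\<close>, \<open>y \<noteq> y\<^sub>0\<close>, and a change
  of the second one would extend it to all points, so \<open>c\<close> would be continuous up to functions of one
  variable.  The base points can be moved because neither space is a singleton: otherwise \<open>c\<close> itself
  would depend on one variable only.
\<close>

lemma cross_difference_discontinuous_off_axes:
  fixes c :: "'a::t2_space \<times> 'b::t2_space \<Rightarrow> real"
  assumes "\<And>f g. \<not> continuous_on UNIV (\<lambda>(x, y). c (x, y) - f x - g y)"
  obtains x\<^sub>0 x y\<^sub>0 y where "x \<noteq> x\<^sub>0" "y \<noteq> y\<^sub>0" "\<not> isCont (cross_difference c x\<^sub>0 y\<^sub>0) (x, y)"
proof (rule ccontr)
  assume "\<not> thesis"
  with that have off: "isCont (cross_difference c x\<^sub>0 y\<^sub>0) (x, y)" if "x \<noteq> x\<^sub>0" "y \<noteq> y\<^sub>0" for x\<^sub>0 x y\<^sub>0 y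
    using that by blast
  have "\<exists>x. x \<noteq> x\<^sub>0" for x\<^sub>0 :: 'a
  proof (rule ccontr)
    assume "\<not> ?thesis"
    then have "(\<lambda>(x, y). c (x, y) - 0 - c (x\<^sub>0, y)) = (\<lambda>_. 0)"
      by (auto simp: fun_eq_iff)
    with assms[of "\<lambda>_. 0" "\<lambda>y. c (x\<^sub>0, y)"] show False
      by simp
  qed
  then obtain other_x :: "'a \<Rightarrow> 'a" where other_x: "other_x x\<^sub>0 \<noteq> x\<^sub>0" for x\<^sub>0
    by metis
  have "\<exists>y. y \<noteq> y\<^sub>0" for y\<^sub>0 :: 'b
  proof (rule ccontr)
    assume "\<not> ?thesis"
    then have "(\<lambda>(x, y). c (x, y) - c (x, y\<^sub>0) - 0) = (\<lambda>_. 0)"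
      by (auto simp: fun_eq_iff)
    with assms[of "\<lambda>x. c (x, y\<^sub>0)" "\<lambda>_. 0"] show False
      by simp
  qed
  then obtain other_y :: "'b \<Rightarrow> 'b" where other_y: "other_y y\<^sub>0 \<noteq> y\<^sub>0" for y\<^sub>0
    by metis
  have off_y: "isCont (cross_difference c x\<^sub>0 y\<^sub>0) (x, y)" if y: "y \<noteq> y\<^sub>0" for x\<^sub>0 x y\<^sub>0 y
  proof (cases "x = x\<^sub>0")
    case True
    show ?thesis
      by (rule isCont_cross_difference_change_x[where x\<^sub>1 = "other_x x\<^sub>0"])
        (use True y other_x in \<open>auto intro!: off simp: not_sym\<close>)
  qed (simp add: off y)
  have everywhere: "isCont (cross_difference c x\<^sub>0 y\<^sub>0) (x, y)" for x\<^sub>0 x y\<^sub>0 y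
  proof (cases "y = y\<^sub>0")
    case True
    show ?thesis
      by (rule isCont_cross_difference_change_y[where y\<^sub>1 = "other_y y\<^sub>0"])
        (use True other_y in \<open>auto intro!: off_y simp: not_sym\<close>)
  qed (simp add: off_y)
  fix x\<^sub>0 :: 'a and y\<^sub>0 :: 'b
  have "continuous_on UNIV (cross_difference c x\<^sub>0 y\<^sub>0)"
    using everywhere by (auto simp: continuous_on_eq_continuous_at)
  also have "cross_difference c x\<^sub>0 y\<^sub>0 =
      (\<lambda>(x, y). c (x, y) - c (x, y\<^sub>0) - (c (x\<^sub>0, y) - c (x\<^sub>0, y\<^sub>0)))"
    by (auto simp: cross_difference_def fun_eq_iff)
  finally show False
    using assms[of "\<lambda>x. c (x, y\<^sub>0)" "\<lambda>y. c (x\<^sub>0, y) - c (x\<^sub>0, y\<^sub>0)"] by contradiction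
qed

section \<open>Couplings of two-point marginals\<close>

text \<open>
  Two fair coins that show the same side with probability \<open>r\<close>.  All measures below are images of this
  distribution, or of a single fair coin, under maps into the spaces; this keeps the points apart
  from their labels, so the same computations apply when points coincide.
\<close>

definition agreeing_coins :: "real \<Rightarrow> (bool \<times> bool) pmf" where
  "agreeing_coins r =
     map_pmf (\<lambda>(i, e). (i, i = e)) (pair_pmf (bernoulli_pmf (1/2)) (bernoulli_pmf r))"

lemma pmf_agreeing_coins:
  assumes "0 \<le> r" "r \<le> 1"
  shows "pmf (agreeing_coins r) (i, j) = (if i = j then r else 1 - r) / 2"
proof -
  have inj: "inj (\<lambda>(i :: bool, e). (i, i = e))"
    by (auto simp: inj_on_def)
  have "pmf (agreeing_coins r) ((\<lambda>(i, e). (i, i = e)) (i, i = j)) = (if i = j then r else 1 - r) / 2"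
    unfolding agreeing_coins_def pmf_map_inj'[OF inj] using assms by (simp add: pmf_pair)
  then show ?thesis by (cases i; cases j) auto
qed

lemma map_fst_agreeing_coins: "map_pmf fst (agreeing_coins r) = bernoulli_pmf (1/2)"
proof -
  have "map_pmf fst (agreeing_coins r) =
      map_pmf fst (pair_pmf (bernoulli_pmf (1/2)) (bernoulli_pmf r))"
    unfolding agreeing_coins_def map_pmf_comp by (rule map_pmf_cong) auto
  then show ?thesis by (simp add: map_fst_pair_pmf)
qed

lemma map_snd_agreeing_coins:
  assumes "0 \<le> r" "r \<le> 1"
  shows "map_pmf snd (agreeing_coins r) = bernoulli_pmf (1/2)"
proof -
  have "map_pmf prod.swap (agreeing_coins r) = agreeing_coins r"
  proof (rule pmf_eqI)
    fix z :: "bool \<times> bool"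
    have "pmf (map_pmf prod.swap (agreeing_coins r)) (prod.swap (prod.swap z)) =
        pmf (agreeing_coins r) (prod.swap z)"
      by (rule pmf_map_inj') simp
    also have "\<dots> = pmf (agreeing_coins r) z"
      using assms by (cases z) (auto simp: pmf_agreeing_coins)
    finally show "pmf (map_pmf prod.swap (agreeing_coins r)) z = pmf (agreeing_coins r) z" by simp
  qed
  then have "map_pmf snd (agreeing_coins r) = map_pmf snd (map_pmf prod.swap (agreeing_coins r))"
    by simp
  also have "\<dots> = map_pmf fst (agreeing_coins r)"
    by (simp add: map_pmf_comp)
  finally show ?thesis
    by (simp add: map_fst_agreeing_coins)
qed

text \<open>
  Independence of fair coins is agreement with probability one half, so the product of the marginals
  belongs to the same family as the couplings.
\<close>

lemma pair_measure_fair_coins: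
  "measure_pmf (bernoulli_pmf (1/2)) \<Otimes>\<^sub>M measure_pmf (bernoulli_pmf (1/2)) =
     measure_pmf (agreeing_coins (1/2))"
proof (rule measure_eqI_countable)
  have "sets (measure_pmf (bernoulli_pmf (1/2)) \<Otimes>\<^sub>M measure_pmf (bernoulli_pmf (1/2))) =
      sets (count_space UNIV \<Otimes>\<^sub>M count_space (UNIV :: bool set))"
    by (intro sets_pair_measure_cong) auto
  then show "sets (measure_pmf (bernoulli_pmf (1/2)) \<Otimes>\<^sub>M measure_pmf (bernoulli_pmf (1/2))) = Pow UNIV"
    by (subst (asm) pair_measure_countable) auto
next
  fix z :: "bool \<times> bool"
  obtain i j where z: "z = (i, j)" by fastforce
  have "emeasure (measure_pmf (bernoulli_pmf (1/2)) \<Otimes>\<^sub>M measure_pmf (bernoulli_pmf (1/2))) ({i} \<times> {j}) =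
     emeasure (bernoulli_pmf (1/2)) {i} * emeasure (bernoulli_pmf (1/2)) {j}"
    by (intro sigma_finite_measure.emeasure_pair_measure_Times
        measure_pmf.sigma_finite_measure_axioms) auto
  also have "\<dots> = ennreal (pmf (bernoulli_pmf (1/2)) i * pmf (bernoulli_pmf (1/2)) j)"
    by (simp only: emeasure_pmf_single ennreal_mult pmf_nonneg)
  also have "pmf (bernoulli_pmf (1/2)) i * pmf (bernoulli_pmf (1/2)) j =
      pmf (agreeing_coins (1/2)) (i, j)"
    by (simp add: pmf_agreeing_coins)
  also have "ennreal \<dots> = emeasure (agreeing_coins (1/2)) {(i, j)}"
    by (simp only: emeasure_pmf_single)
  finally show "emeasure (measure_pmf (bernoulli_pmf (1/2)) \<Otimes>\<^sub>M measure_pmf (bernoulli_pmf (1/2))) {z} =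
      emeasure (agreeing_coins (1/2)) {z}"
    by (simp add: z)
qed simp_all

definition corner :: "'a \<Rightarrow> 'b \<Rightarrow> 'a \<Rightarrow> 'b \<Rightarrow> bool \<times> bool \<Rightarrow> 'a \<times> 'b" where
  "corner x\<^sub>0 y\<^sub>0 x y = (\<lambda>(i, j). (if i then x else x\<^sub>0, if j then y else y\<^sub>0))"

definition two_point :: "'a \<Rightarrow> 'a \<Rightarrow> 'a::topological_space measure" where
  "two_point x\<^sub>0 x = distr (bernoulli_pmf (1/2)) borel (\<lambda>i. if i then x else x\<^sub>0)"

definition four_point ::
  "real \<Rightarrow> 'a \<Rightarrow> 'b \<Rightarrow> 'a \<Rightarrow> 'b \<Rightarrow> ('a::topological_space \<times> 'b::topological_space) measure" where
  "four_point r x\<^sub>0 y\<^sub>0 x y = distr (agreeing_coins r) borel (corner x\<^sub>0 y\<^sub>0 x y)"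

lemma two_point_in_borel_probs: "two_point x\<^sub>0 x \<in> borel_probs"
  unfolding borel_probs_def two_point_def by (auto intro!: measure_pmf.prob_space_distr)

lemma four_point_in_couplings:
  fixes x :: "'a::topological_space" and y :: "'b::topological_space"
  assumes "0 \<le> r" "r \<le> 1"
  shows "four_point r x\<^sub>0 y\<^sub>0 x y \<in> couplings (two_point x\<^sub>0 x) (two_point y\<^sub>0 y)"
proof -
  have [measurable]: "fst \<in> (borel :: ('a \<times> 'b) measure) \<rightarrow>\<^sub>M borel"
    "snd \<in> (borel :: ('a \<times> 'b) measure) \<rightarrow>\<^sub>M borel"
    by (auto intro!: borel_measurable_continuous_onI continuous_intros)
  have "distr (four_point r x\<^sub>0 y\<^sub>0 x y) borel fst =
      distr (map_pmf fst (agreeing_coins r)) borel (\<lambda>i. if i then x else x\<^sub>0)"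
    unfolding four_point_def map_pmf_rep_eq
    by (simp add: distr_distr corner_def comp_def case_prod_unfold)
  moreover have "distr (four_point r x\<^sub>0 y\<^sub>0 x y) borel snd =
      distr (map_pmf snd (agreeing_coins r)) borel (\<lambda>i. if i then y else y\<^sub>0)"
    unfolding four_point_def map_pmf_rep_eq
    by (simp add: distr_distr corner_def comp_def case_prod_unfold)
  moreover have "four_point r x\<^sub>0 y\<^sub>0 x y \<in> borel_probs"
    unfolding borel_probs_def four_point_def by (auto intro!: measure_pmf.prob_space_distr)
  ultimately show ?thesis
    using assms by (simp add: couplings_def two_point_def map_fst_agreeing_coins map_snd_agreeing_coins)
qed

lemma pair_measure_two_point:
  fixes x :: "'a::second_countable_topology" and y :: "'b::second_countable_topology"
  shows "two_point x\<^sub>0 x \<Otimes>\<^sub>M two_point y\<^sub>0 y = four_point (1/2) x\<^sub>0 y\<^sub>0 x y"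
proof -
  interpret Y: prob_space "two_point y\<^sub>0 y"
    using two_point_in_borel_probs[of y\<^sub>0 y] by (simp add: borel_probs_def)
  show ?thesis
    using Y.sigma_finite_measure_axioms unfolding two_point_def four_point_def corner_def
    by (subst pair_measure_distr) (auto simp: pair_measure_fair_coins borel_prod)
qed

lemma density_two_point:
  fixes x :: "'a::second_countable_topology" and y :: "'b::second_countable_topology"
  assumes [measurable]: "Z \<in> borel_measurable borel"
  shows "density (two_point x\<^sub>0 x \<Otimes>\<^sub>M two_point y\<^sub>0 y) (\<lambda>z. ennreal (Z z)) =
    distr (density (agreeing_coins (1/2)) (\<lambda>ij. ennreal (Z (corner x\<^sub>0 y\<^sub>0 x y ij))))
      borel (corner x\<^sub>0 y\<^sub>0 x y)"
  unfolding pair_measure_two_point four_point_def by (rule density_distr) auto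

lemma emeasure_density_fair_coins:
  assumes "\<And>ij. 0 \<le> W ij"
  shows "emeasure (density (agreeing_coins (1/2)) (\<lambda>ij. ennreal (W ij))) {ij} = ennreal (W ij / 4)"
proof -
  have "emeasure (density (agreeing_coins (1/2)) (\<lambda>ij. ennreal (W ij))) {ij} =
      ennreal (W ij) * emeasure (agreeing_coins (1/2)) {ij}"
    by (simp add: emeasure_density nn_integral_indicator_singleton)
  also have "\<dots> = ennreal (W ij / 4)"
    using assms by (cases ij) (simp add: emeasure_pmf_single pmf_agreeing_coins flip: ennreal_mult)
  finally show ?thesis .
qed

text \<open>
  Each pair of labels has mass \<open>1 / 4\<close> under the product, so a function whose value at each corner is
  four times the coupling's mass of its labels is a density, even if corners coincide.  Recovering
  these values from a density requires distinct corners, since otherwise only sums of masses are seen.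
\<close>

lemma four_point_eq_density:
  fixes x :: "'a::second_countable_topology" and y :: "'b::second_countable_topology"
  assumes "Z \<in> borel_measurable borel" and "0 \<le> r" "r \<le> 1"
    and Z: "\<And>i j. Z (corner x\<^sub>0 y\<^sub>0 x y (i, j)) = 2 * (if i = j then r else 1 - r)"
  shows "four_point r x\<^sub>0 y\<^sub>0 x y = density (two_point x\<^sub>0 x \<Otimes>\<^sub>M two_point y\<^sub>0 y) (\<lambda>z. ennreal (Z z))"
proof -
  have "0 \<le> Z (corner x\<^sub>0 y\<^sub>0 x y ij)" for ij
    using assms by (cases ij) simp
  then have "measure_pmf (agreeing_coins r) =
      density (agreeing_coins (1/2)) (\<lambda>ij. ennreal (Z (corner x\<^sub>0 y\<^sub>0 x y ij)))"
    using assms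
    by (intro measure_eqI_countable[where A = UNIV])
       (auto simp: emeasure_density_fair_coins emeasure_pmf_single pmf_agreeing_coins)
  then show ?thesis
    unfolding density_two_point[OF assms(1)] by (simp add: four_point_def)
qed

lemma density_at_corner:
  fixes x :: "'a::{second_countable_topology, t1_space}"
    and y :: "'b::{second_countable_topology, t1_space}"
  assumes "Z \<in> borel_measurable borel" "\<And>z. 0 \<le> Z z" and "0 \<le> r" "r \<le> 1"
    and "x \<noteq> x\<^sub>0" "y \<noteq> y\<^sub>0"
    and eq: "four_point r x\<^sub>0 y\<^sub>0 x y = density (two_point x\<^sub>0 x \<Otimes>\<^sub>M two_point y\<^sub>0 y) (\<lambda>z. ennreal (Z z))"
  shows "Z (corner x\<^sub>0 y\<^sub>0 x y (i, j)) = 2 * (if i = j then r else 1 - r)"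
proof -
  let ?G = "corner x\<^sub>0 y\<^sub>0 x y"
  have vimage: "?G -` {?G (i, j)} = {(i, j)}"
    using assms by (auto simp: corner_def split: if_splits)
  have borel: "{?G (i, j)} \<in> sets borel"
    by (rule borel_closed[OF closed_singleton])
  have "ennreal (pmf (agreeing_coins r) (i, j)) = emeasure (four_point r x\<^sub>0 y\<^sub>0 x y) {?G (i, j)}"
    unfolding four_point_def using borel by (simp add: emeasure_distr vimage emeasure_pmf_single)
  also have "\<dots> = ennreal (Z (?G (i, j)) / 4)"
    unfolding eq density_two_point[OF assms(1)]
    using borel assms(2) by (simp add: emeasure_distr vimage emeasure_density_fair_coins)
  finally have "pmf (agreeing_coins r) (i, j) = Z (?G (i, j)) / 4"
    using assms(2) by (subst (asm) ennreal_inj) auto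
  then show ?thesis
    using assms(3,4) by (simp add: pmf_agreeing_coins)
qed

section \<open>Cyclic invariance of the four-point couplings\<close>

text \<open>
  Along a cycle the \<open>x\<^sub>i\<close> are the same on both sides and the \<open>y\<^sub>i\<close> are only shifted cyclically, so the
  contributions of the potentials \<open>f\<close> and \<open>g\<close> cancel.
\<close>

lemma cycle_identity_of_potentials:
  fixes c :: "'a \<times> 'b \<Rightarrow> real" and x :: "nat \<Rightarrow> 'a" and y :: "nat \<Rightarrow> 'b"
  assumes Z: "\<And>x y. Z (x, y) = exp (- (1 / \<epsilon>) * c (x, y) + f x + g y)"
    and y: "y (k + 1) = y 1" and "k \<ge> 1"
  shows "(\<Prod>i=1..k. Z (x i, y i)) =
     exp (- (1 / \<epsilon>) * ((\<Sum>i=1..k. c (x i, y i)) - (\<Sum>i=1..k. c (x i, y (i + 1))))) *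
       (\<Prod>i=1..k. Z (x i, y (i + 1)))"
proof -
  have "(\<Sum>i=1..k. g (y (Suc i)) - g (y i)) = 0"
    using y \<open>k \<ge> 1\<close> by (subst sum_Suc_diff) auto
  then have "(\<Sum>i=1..k. g (y (i + 1))) = (\<Sum>i=1..k. g (y i))"
    by (simp add: sum_subtractf)
  then show ?thesis
    unfolding Z exp_sum[OF finite_atLeastAtMost, symmetric] exp_add[symmetric]
    by (simp add: sum.distrib sum_subtractf sum_negf diff_divide_distrib flip: sum_divide_distrib)
qed

text \<open>
  The potentials are chosen such that the density is
  \<open>2 r exp(-D(u, v)) e\<^sub>1(u) e\<^sub>2(v)\<close>, where \<open>D\<close> vanishes on the axes through the base point and each
  \<open>e\<^sub>i\<close> is \<open>1\<close> at the base point and the odds \<open>(1 - r) / r = exp(D(x, y) / 2)\<close> elsewhere.  It then has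
  the value \<open>2 r\<close> at the base point and \<open>2 (1 - r)\<close> at the two mixed corners, and the choice of \<open>r\<close>
  makes it \<open>2 r\<close> again at the fourth corner.
\<close>

lemma four_point_cyclically_invariant:
  fixes c :: "'a::{second_countable_topology, t2_space} \<times> 'b::{second_countable_topology, t2_space} \<Rightarrow> real"
  assumes c: "c \<in> borel_measurable borel"
    and r: "r = 1 / (1 + exp (cross_difference c x\<^sub>0 y\<^sub>0 (x, y) / 2))"
  shows "cyclically_invariant c 1 (two_point x\<^sub>0 x) (two_point y\<^sub>0 y) (four_point r x\<^sub>0 y\<^sub>0 x y)"
proof -
  define s where "s = cross_difference c x\<^sub>0 y\<^sub>0 (x, y) / 2"
  have "0 < 1 + exp s"
    by (intro add_pos_pos) auto
  then have r': "0 < r" "r < 1" and rs: "r * exp s = 1 - r"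
    unfolding r s_def[symmetric] by (simp_all add: field_simps)
  define f where "f = (\<lambda>u. c (u, y\<^sub>0) + (if u = x\<^sub>0 then 0 else s))"
  define g where "g = (\<lambda>v. c (x\<^sub>0, v) - c (x\<^sub>0, y\<^sub>0) + (if v = y\<^sub>0 then 0 else s) + ln (2 * r))"
  define Z where "Z = (\<lambda>z. exp (- (1 / 1) * c z + f (fst z) + g (snd z)))"
  have c'[measurable]: "c \<in> borel_measurable (borel \<Otimes>\<^sub>M borel)"
    using c by (simp add: borel_prod)
  have [measurable]: "f \<in> borel_measurable borel" "g \<in> borel_measurable borel"
    unfolding f_def g_def by measurable
  have "Z \<in> borel_measurable (borel \<Otimes>\<^sub>M borel)"
    unfolding Z_def by measurable
  then have Z_meas[measurable]: "Z \<in> borel_measurable borel"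
    by (simp add: borel_prod)
  have Z_eq: "Z (u, v) = 2 * r * exp (- cross_difference c x\<^sub>0 y\<^sub>0 (u, v)) *
      (if u = x\<^sub>0 then 1 else exp s) * (if v = y\<^sub>0 then 1 else exp s)" for u v
  proof -
    have "Z (u, v) = exp (ln (2 * r) + (- cross_difference c x\<^sub>0 y\<^sub>0 (u, v)) +
        (if u = x\<^sub>0 then 0 else s) + (if v = y\<^sub>0 then 0 else s))"
      unfolding Z_def f_def g_def cross_difference_def by (simp add: algebra_simps)
    then show ?thesis
      using r' unfolding exp_add by simp
  qed
  have axes: "cross_difference c x\<^sub>0 y\<^sub>0 (x\<^sub>0, v) = 0" "cross_difference c x\<^sub>0 y\<^sub>0 (u, y\<^sub>0) = 0" for u v
    by (auto simp: cross_difference_def)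
  \<comment> \<open>If corners coincide, then \<open>r = 1 / 2\<close> and the coupling is the product.\<close>
  have degenerate: "s = 0" if "x = x\<^sub>0 \<or> y = y\<^sub>0"
    using that axes by (auto simp: s_def)
  have cancel: "exp (- cross_difference c x\<^sub>0 y\<^sub>0 (x, y)) * exp s * exp s = 1"
    by (simp add: s_def flip: exp_add)
  have corners: "Z (corner x\<^sub>0 y\<^sub>0 x y (i, j)) = 2 * (if i = j then r else 1 - r)" for i j
    using rs cancel degenerate unfolding corner_def
    by (cases i; cases j) (auto simp: Z_eq axes mult.assoc)
  have eq: "four_point r x\<^sub>0 y\<^sub>0 x y = density (two_point x\<^sub>0 x \<Otimes>\<^sub>M two_point y\<^sub>0 y) (\<lambda>z. ennreal (Z z))"
    using Z_meas r' corners by (intro four_point_eq_density) auto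
  have sets: "sets (two_point x\<^sub>0 x \<Otimes>\<^sub>M two_point y\<^sub>0 y) = sets borel"
    unfolding pair_measure_two_point four_point_def by simp
  have Zm: "(\<lambda>z. ennreal (Z z)) \<in> borel_measurable (two_point x\<^sub>0 x \<Otimes>\<^sub>M two_point y\<^sub>0 y)"
    unfolding measurable_cong_sets[OF sets refl] by measurable
  have pos: "0 < Z z" for z
    by (simp add: Z_def)
  have ac: "absolutely_continuous (two_point x\<^sub>0 x \<Otimes>\<^sub>M two_point y\<^sub>0 y) (four_point r x\<^sub>0 y\<^sub>0 x y)"
    unfolding eq by (rule absolutely_continuousI_density[OF Zm])
  have ca: "absolutely_continuous (four_point r x\<^sub>0 y\<^sub>0 x y) (two_point x\<^sub>0 x \<Otimes>\<^sub>M two_point y\<^sub>0 y)"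
    unfolding eq absolutely_continuous_def
    by (auto simp: null_sets_density_iff[OF Zm] ennreal_eq_0_iff pos[THEN not_le[THEN iffD2]]
        simp flip: AE_iff_null_sets)
  show ?thesis
    unfolding cyclically_invariant_def
  proof (intro conjI exI[of _ Z] allI impI)
    show "four_point r x\<^sub>0 y\<^sub>0 x y \<in> couplings (two_point x\<^sub>0 x) (two_point y\<^sub>0 y)"
      using r' by (intro four_point_in_couplings) auto
  next
    fix k :: nat and u :: "nat \<Rightarrow> 'a" and v :: "nat \<Rightarrow> 'b"
    assume "1 \<le> k" "v (k + 1) = v 1"
    then show "(\<Prod>i=1..k. Z (u i, v i)) =
        exp (- (1 / 1) * ((\<Sum>i=1..k. c (u i, v i)) - (\<Sum>i=1..k. c (u i, v (i + 1))))) *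
        (\<Prod>i=1..k. Z (u i, v (i + 1)))"
      by (intro cycle_identity_of_potentials[where f = f and g = g]) (simp_all add: Z_def)
  qed (use Z_meas pos eq ac ca in auto)
qed

text \<open>
  Conversely, the cycle through the four corners already determines \<open>r\<close>.  The boundary values \<open>0\<close> and
  \<open>1\<close> are included because they occur as limits.
\<close>

lemma agreement_of_cyclically_invariant:
  fixes c :: "'a::{second_countable_topology, t1_space} \<times> 'b::{second_countable_topology, t1_space} \<Rightarrow> real"
  assumes inv: "cyclically_invariant c 1 (two_point x\<^sub>0 x) (two_point y\<^sub>0 y) (four_point r x\<^sub>0 y\<^sub>0 x y)"
    and "x \<noteq> x\<^sub>0" "y \<noteq> y\<^sub>0" and r: "0 \<le> r" "r \<le> 1"
  shows "r = 1 / (1 + exp (cross_difference c x\<^sub>0 y\<^sub>0 (x, y) / 2))"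
proof -
  define d where "d = cross_difference c x\<^sub>0 y\<^sub>0 (x, y)"
  obtain Z where Z: "Z \<in> borel_measurable borel" "\<And>z. Z z > 0"
      "four_point r x\<^sub>0 y\<^sub>0 x y = density (two_point x\<^sub>0 x \<Otimes>\<^sub>M two_point y\<^sub>0 y) (\<lambda>z. ennreal (Z z))"
    and cyc: "\<And>k (u :: nat \<Rightarrow> 'a) (v :: nat \<Rightarrow> 'b). k \<ge> 1 \<Longrightarrow> v (k + 1) = v 1 \<Longrightarrow>
           (\<Prod>i=1..k. Z (u i, v i)) =
             exp (- (1 / 1) * ((\<Sum>i=1..k. c (u i, v i)) - (\<Sum>i=1..k. c (u i, v (i + 1))))) *
             (\<Prod>i=1..k. Z (u i, v (i + 1)))"
    using inv unfolding cyclically_invariant_def by blast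
  have corners: "Z (corner x\<^sub>0 y\<^sub>0 x y (i, j)) = 2 * (if i = j then r else 1 - r)" for i j
    using Z assms by (intro density_at_corner) (auto intro: less_imp_le)
  have vals: "Z (x, y) = 2 * r" "Z (x, y\<^sub>0) = 2 * (1 - r)" "Z (x\<^sub>0, y) = 2 * (1 - r)" "Z (x\<^sub>0, y\<^sub>0) = 2 * r"
    using corners[of True True] corners[of True False] corners[of False True] corners[of False False]
    by (auto simp: corner_def)
  \<comment> \<open>The cycle visits \<open>(x, y)\<close> at index 1 and \<open>(x\<^sub>0, y\<^sub>0)\<close> at index 2; at index 3 the second coordinate
    is \<open>y\<close> again.\<close>
  have "Z (x, y) * Z (x\<^sub>0, y\<^sub>0) = exp (- d) * (Z (x, y\<^sub>0) * Z (x\<^sub>0, y))"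
    using cyc[of 2 "\<lambda>i. if i = 2 then y\<^sub>0 else y" "\<lambda>i. if i = 2 then x\<^sub>0 else x"]
    by (simp add: numeral_2_eq_2 d_def cross_difference_def algebra_simps)
  then have "(2 * r)\<^sup>2 = exp (- d) * (2 * (1 - r))\<^sup>2"
    by (simp only: vals power2_eq_square)
  then have "r\<^sup>2 = exp (- d) * (1 - r)\<^sup>2"
    unfolding power_mult_distrib by simp
  also have "\<dots> = (exp (- (d / 2)) * (1 - r))\<^sup>2"
    using exp_double[of "- (d / 2)"] by (simp add: power_mult_distrib)
  finally have "r = exp (- (d / 2)) * (1 - r)"
    by (rule power2_eq_imp_eq) (use r in auto)
  then have "r * exp (d / 2) = 1 - r"
    using exp_minus_inverse[of "d / 2"] by (metis mult.assoc mult.commute mult_1)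
  then have "r * (1 + exp (d / 2)) = 1"
    by (simp add: algebra_simps)
  moreover have "0 < 1 + exp (d / 2)"
    by (intro add_pos_pos) auto
  ultimately show ?thesis
    unfolding d_def[symmetric] by (simp add: eq_divide_eq)
qed

section \<open>Weak limits and the failure of stability\<close>

lemma two_point_weakly_converges:
  assumes "xs \<longlonglongrightarrow> x"
  shows "weakly_converges (\<lambda>n. two_point x\<^sub>0 (xs n)) (two_point x\<^sub>0 x)"
  unfolding weakly_converges_def
proof (intro allI impI, elim conjE)
  fix f :: "'a \<Rightarrow> real" assume f: "continuous_on UNIV f"
  then have [measurable]: "f \<in> borel_measurable borel"
    by (rule borel_measurable_continuous_onI)
  have "(\<integral>z. f z \<partial>two_point x\<^sub>0 u) = (f u + f x\<^sub>0) / 2" for u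
    by (simp add: two_point_def integral_distr add_divide_distrib)
  moreover have "(\<lambda>n. (f (xs n) + f x\<^sub>0) / 2) \<longlonglongrightarrow> (f x + f x\<^sub>0) / 2"
    by (intro tendsto_intros continuous_on_tendsto_compose[OF f assms]) auto
  ultimately show "(\<lambda>n. \<integral>z. f z \<partial>two_point x\<^sub>0 (xs n)) \<longlonglongrightarrow> (\<integral>z. f z \<partial>two_point x\<^sub>0 x)"
    by (simp only:)
qed

lemma four_point_weakly_converges:
  assumes "xs \<longlonglongrightarrow> x" "ys \<longlonglongrightarrow> y" "rs \<longlonglongrightarrow> r"
    and rs: "\<And>n. 0 \<le> rs n" "\<And>n. rs n \<le> 1"
  shows "weakly_converges (\<lambda>n. four_point (rs n) x\<^sub>0 y\<^sub>0 (xs n) (ys n)) (four_point r x\<^sub>0 y\<^sub>0 x y)"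
  unfolding weakly_converges_def
proof (intro allI impI, elim conjE)
  fix f :: "'a \<times> 'b \<Rightarrow> real" assume f: "continuous_on UNIV f"
  then have [measurable]: "f \<in> borel_measurable borel"
    by (rule borel_measurable_continuous_onI)
  have r: "0 \<le> r" "r \<le> 1"
    using assms(3) rs by (auto intro: LIMSEQ_le_const LIMSEQ_le_const2)
  have "(\<integral>z. f z \<partial>four_point p x\<^sub>0 y\<^sub>0 u v) =
      p / 2 * (f (u, v) + f (x\<^sub>0, y\<^sub>0)) + (1 - p) / 2 * (f (u, y\<^sub>0) + f (x\<^sub>0, v))"
    if "0 \<le> p" "p \<le> 1" for p u v
  proof -
    have "(\<integral>z. f z \<partial>four_point p x\<^sub>0 y\<^sub>0 u v) =
        (\<integral>ij. f (corner x\<^sub>0 y\<^sub>0 u v ij) \<partial>agreeing_coins p)"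
      by (simp add: four_point_def integral_distr)
    also have "\<dots> = (\<Sum>ij\<in>UNIV. pmf (agreeing_coins p) ij *\<^sub>R f (corner x\<^sub>0 y\<^sub>0 u v ij))"
      by (rule integral_measure_pmf) auto
    also have "\<dots> = (\<Sum>i\<in>UNIV. \<Sum>j\<in>UNIV. pmf (agreeing_coins p) (i, j) *\<^sub>R f (corner x\<^sub>0 y\<^sub>0 u v (i, j)))"
      by (simp add: sum.cartesian_product)
    also have "\<dots> = p / 2 * (f (u, v) + f (x\<^sub>0, y\<^sub>0)) + (1 - p) / 2 * (f (u, y\<^sub>0) + f (x\<^sub>0, v))"
      using that by (simp add: UNIV_bool pmf_agreeing_coins corner_def ring_distribs)
    finally show ?thesis .
  qed
  moreover have "(\<lambda>n. rs n / 2 * (f (xs n, ys n) + f (x\<^sub>0, y\<^sub>0)) +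
        (1 - rs n) / 2 * (f (xs n, y\<^sub>0) + f (x\<^sub>0, ys n)))
      \<longlonglongrightarrow> r / 2 * (f (x, y) + f (x\<^sub>0, y\<^sub>0)) + (1 - r) / 2 * (f (x, y\<^sub>0) + f (x\<^sub>0, y))"
    by (intro tendsto_intros continuous_on_tendsto_compose[OF f] assms) auto
  ultimately show "(\<lambda>n. \<integral>z. f z \<partial>four_point (rs n) x\<^sub>0 y\<^sub>0 (xs n) (ys n)) \<longlonglongrightarrow>
      (\<integral>z. f z \<partial>four_point r x\<^sub>0 y\<^sub>0 x y)"
    using rs r by simp
qed

text \<open>
  The limit lies strictly inside the unit interval, where the logistic function has the continuous
  inverse \<open>2 ln(1 / p - 1)\<close>.
\<close>

lemma tendsto_of_tendsto_logistic:
  fixes d :: "nat \<Rightarrow> real"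
  assumes "(\<lambda>n. 1 / (1 + exp (d n / 2))) \<longlonglongrightarrow> 1 / (1 + exp (l / 2))"
  shows "d \<longlonglongrightarrow> l"
proof -
  have inverse: "2 * ln (1 / (1 / (1 + exp (t / 2))) - 1) = t" for t :: real
    by simp
  have pos: "1 + exp (l / 2) \<noteq> 0"
    using exp_gt_zero[of "l / 2"] by linarith
  have "(\<lambda>n. 2 * ln (1 / (1 / (1 + exp (d n / 2))) - 1)) \<longlonglongrightarrow>
      2 * ln (1 / (1 / (1 + exp (l / 2))) - 1)"
    using pos by (intro tendsto_intros assms) auto
  then show ?thesis
    unfolding inverse .
qed

lemma not_tendsto_imp_other_limit:
  fixes s :: "nat \<Rightarrow> 'a::metric_space"
  assumes "compact K" "\<And>n. s n \<in> K" "\<not> s \<longlonglongrightarrow> l"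
  obtains \<phi> l' where "strict_mono \<phi>" "l' \<in> K" "(s \<circ> \<phi>) \<longlonglongrightarrow> l'" "l' \<noteq> l"
proof -
  obtain e where e: "e > 0" and "\<And>N. \<exists>n\<ge>N. \<not> dist (s n) l < e"
    using assms(3) unfolding lim_sequentially by blast
  then have "\<exists>\<^sub>\<infinity>n. \<not> dist (s n) l < e"
    by (simp add: INFM_nat_le)
  then obtain \<phi> :: "nat \<Rightarrow> nat" where \<phi>: "strict_mono \<phi>" "\<And>n. \<not> dist (s (\<phi> n)) l < e"
    using infinite_enumerate[of "{n. \<not> dist (s n) l < e}"] by (auto simp: frequently_cofinite)
  obtain l' \<psi> where l': "l' \<in> K" "strict_mono \<psi>" "((s \<circ> \<phi>) \<circ> \<psi>) \<longlonglongrightarrow> l'"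
    using assms(1,2) unfolding compact_eq_seq_compact_metric seq_compact_def by (metis comp_apply)
  have "l' \<noteq> l"
  proof
    assume "l' = l"
    with l'(3) e obtain n where "dist (((s \<circ> \<phi>) \<circ> \<psi>) n) l < e"
      unfolding lim_sequentially by blast
    with \<phi>(2) show False by simp
  qed
  with l' \<phi>(1) show thesis
    by (intro that[of "\<phi> \<circ> \<psi>" l']) (auto simp: o_assoc strict_mono_o)
qed

theorem proposition5p3:
  fixes c :: "'a::polish_space \<times> 'b::polish_space \<Rightarrow> real"
  assumes c_meas: "c \<in> borel_measurable borel"
    and c_nonneg: "\<And>z. c z \<ge> 0"
    and c_discont: "\<And>(f :: 'a \<Rightarrow> real) (g :: 'b \<Rightarrow> real).
          \<not> continuous_on UNIV (\<lambda>(x, y). c (x, y) - f x - g y)"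
  shows "\<exists>(\<mu>s :: nat \<Rightarrow> 'a measure) (\<nu>s :: nat \<Rightarrow> 'b measure) \<mu> \<nu>
            (\<pi>s :: nat \<Rightarrow> ('a \<times> 'b) measure) \<pi>.
          (\<forall>n. \<mu>s n \<in> borel_probs \<and> \<nu>s n \<in> borel_probs) \<and>
          \<mu> \<in> borel_probs \<and> \<nu> \<in> borel_probs \<and>
          weakly_converges \<mu>s \<mu> \<and> weakly_converges \<nu>s \<nu> \<and>
          (\<forall>n. \<pi>s n \<in> couplings (\<mu>s n) (\<nu>s n) \<and>
               cyclically_invariant c 1 (\<mu>s n) (\<nu>s n) (\<pi>s n)) \<and>
          \<pi> \<in> couplings \<mu> \<nu> \<and> weakly_converges \<pi>s \<pi> \<and>
          \<not> cyclically_invariant c 1 \<mu> \<nu> \<pi>"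
proof -
  obtain x\<^sub>0 x y\<^sub>0 y where distinct: "x \<noteq> x\<^sub>0" "y \<noteq> y\<^sub>0"
    and discont: "\<not> isCont (cross_difference c x\<^sub>0 y\<^sub>0) (x, y)"
    using cross_difference_discontinuous_off_axes[of c] c_discont by metis
  define agreement where "agreement z = 1 / (1 + exp (cross_difference c x\<^sub>0 y\<^sub>0 z / 2))" for z
  have agreement: "0 \<le> agreement z" "agreement z \<le> 1" for z
    unfolding agreement_def by (auto simp: field_simps add_pos_pos intro: add_nonneg_nonneg)
  obtain zs where zs: "zs \<longlonglongrightarrow> (x, y)"
    and "\<not> (\<lambda>n. cross_difference c x\<^sub>0 y\<^sub>0 (zs n)) \<longlonglongrightarrow> cross_difference c x\<^sub>0 y\<^sub>0 (x, y)"
    using discont continuous_at_sequentiallyI by blast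
  then have "\<not> (\<lambda>n. agreement (zs n)) \<longlonglongrightarrow> agreement (x, y)"
    unfolding agreement_def using tendsto_of_tendsto_logistic[of "\<lambda>n. cross_difference c x\<^sub>0 y\<^sub>0 (zs n)"] by blast
  moreover have "agreement (zs n) \<in> {0..1}" for n
    using agreement by simp
  ultimately obtain \<phi> r where \<phi>: "strict_mono \<phi>" and r: "r \<in> {0..1}" "r \<noteq> agreement (x, y)"
    and lim: "((\<lambda>n. agreement (zs n)) \<circ> \<phi>) \<longlonglongrightarrow> r"
    using not_tendsto_imp_other_limit[OF compact_Icc, of "\<lambda>n. agreement (zs n)" 0 1 "agreement (x, y)"]
    by metis
  define xs where "xs n = fst (zs (\<phi> n))" for n
  define ys where "ys n = snd (zs (\<phi> n))" for n
  define rs where "rs n = agreement (xs n, ys n)" for n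
  have "(\<lambda>n. zs (\<phi> n)) \<longlonglongrightarrow> (x, y)"
    using LIMSEQ_subseq_LIMSEQ[OF zs \<phi>] by (simp add: comp_def)
  from tendsto_fst[OF this] tendsto_snd[OF this]
  have xs: "xs \<longlonglongrightarrow> x" and ys: "ys \<longlonglongrightarrow> y"
    by (simp_all add: xs_def[abs_def] ys_def[abs_def])
  have rs: "rs \<longlonglongrightarrow> r"
    using lim by (simp add: rs_def[abs_def] xs_def ys_def comp_def)
  have rs_bounds: "0 \<le> rs n" "rs n \<le> 1" for n
    using agreement by (auto simp: rs_def)
  have "\<not> cyclically_invariant c 1 (two_point x\<^sub>0 x) (two_point y\<^sub>0 y) (four_point r x\<^sub>0 y\<^sub>0 x y)"
    using agreement_of_cyclically_invariant[of c x\<^sub>0 x y\<^sub>0 y r] distinct r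
    by (auto simp: agreement_def)
  moreover have "cyclically_invariant c 1 (two_point x\<^sub>0 (xs n)) (two_point y\<^sub>0 (ys n))
      (four_point (rs n) x\<^sub>0 y\<^sub>0 (xs n) (ys n))" for n
    by (intro four_point_cyclically_invariant c_meas) (simp add: rs_def agreement_def)
  ultimately show ?thesis
    by (intro exI[of _ "\<lambda>n. two_point x\<^sub>0 (xs n)"] exI[of _ "\<lambda>n. two_point y\<^sub>0 (ys n)"]
        exI[of _ "two_point x\<^sub>0 x"] exI[of _ "two_point y\<^sub>0 y"]
        exI[of _ "\<lambda>n. four_point (rs n) x\<^sub>0 y\<^sub>0 (xs n) (ys n)"]
        exI[of _ "four_point r x\<^sub>0 y\<^sub>0 x y"] conjI allI
        two_point_in_borel_probs four_point_in_couplings rs_bounds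
        two_point_weakly_converges[OF xs] two_point_weakly_converges[OF ys]
        four_point_weakly_converges[OF xs ys rs rs_bounds])
      (use r in auto)
qed

end
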